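(* Let $0<\alpha<1$. Then $H_\alpha^\omega$ is the closure of $H_\alpha^p$ in $H_\alpha$.
   Context: Scalars are real or complex. For $0<\alpha<1$, $H_\alpha$ is the Banach space of all scalar-valued functions $f$ on $[0,1]$ with $f(0)=0$ and $L(f)=\sup_{x\ne y}\frac{|f(x)-f(y)|}{|x-y|^\alpha}<\infty$, normed by $L(\cdot)$. A point $x\in[0,1]$ is a noncritical point of a function $h$ on $[0,1]$ if there is a neighbourhood $U_x$ of $x$ in $[0,1]$ on which $h$ satisfies the uniform lip-condition, i.e. $\lim_{|u-v|\to0,\ u\ne v,\ u,v\in U_x}\frac{|h(u)-h(v)|}{|u-v|^\alpha}=0$; otherwise $x$ is a critical point of $h$. $H_\alpha^p$ is the subspace of all functions in $H_\alpha$ which have (only) finitely many critical points. $H_\alpha^\omega$ is the subspace of all $h\in H_\alpha$ with the following property: for any $\varepsilon>0$ there are finitely many points $x_1,\dots,x_n\in[0,1]$ such that every $\tilde x\in[0,1]\setminus\{x_1,\dots,x_n\}$ has a neighbourhood $U(\tilde x)$ (in $[0,1]$) with $\sup_{x,y\in U(\tilde x),\,x\neq y}\frac{|h(x)-h(y)|}{|x-y|^\alpha}\le\varepsilon$. *)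

theory Defs
  imports "HOL-Analysis.Analysis" "HOL-Library.Going_To_Filter"
begin

text \<open>
  The scalar field is an arbitrary type of class \<^class>\<open>real_normed_field\<close>. Up to isometric
  isomorphism these are exactly the real and the complex numbers.

  A function on \<open>[0,1]\<close> is represented by a function on all of \<^typ>\<open>real\<close>.
\<close>

definition holder_quotient :: "real \<Rightarrow> (real \<Rightarrow> 'a::real_normed_field) \<Rightarrow> real \<times> real \<Rightarrow> real" where
  "holder_quotient \<alpha> f = (\<lambda>(x, y). norm (f x - f y) / \<bar>x - y\<bar> powr \<alpha>)"

definition off_diag :: "real set \<Rightarrow> (real \<times> real) set" where
  "off_diag U = {(x, y). x \<in> U \<and> y \<in> U \<and> x \<noteq> y}"

text \<open>The supremum is taken in \<open>[0,\<infinity>]\<close>, so it is meaningful for unbounded quotients too.\<close>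

definition holder_sup :: "real \<Rightarrow> real set \<Rightarrow> (real \<Rightarrow> 'a::real_normed_field) \<Rightarrow> ennreal" where
  "holder_sup \<alpha> U f = (SUP p \<in> off_diag U. ennreal (holder_quotient \<alpha> f p))"

text \<open>
  The condition \<open>f x = 0\<close> off \<open>[0,1]\<close> only fixes one representative for each function on
  \<open>[0,1]\<close>; it is compatible with the pointwise vector space operations.
\<close>

definition holder_space :: "real \<Rightarrow> (real \<Rightarrow> 'a::real_normed_field) set" where
  "holder_space \<alpha> = {f. (\<forall>x. x \<notin> {0..1} \<longrightarrow> f x = 0) \<and> f 0 = 0 \<and> holder_sup \<alpha> {0..1} f < \<infinity>}"

definition holder_norm :: "real \<Rightarrow> (real \<Rightarrow> 'a::real_normed_field) \<Rightarrow> real" where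
  "holder_norm \<alpha> f = enn2real (holder_sup \<alpha> {0..1} f)"

definition holder_dist ::
    "real \<Rightarrow> (real \<Rightarrow> 'a::real_normed_field) \<Rightarrow> (real \<Rightarrow> 'a) \<Rightarrow> real" where
  "holder_dist \<alpha> f g = holder_norm \<alpha> (\<lambda>x. f x - g x)"

definition nhd_unit :: "real \<Rightarrow> real set \<Rightarrow> bool" where
  "nhd_unit x U \<longleftrightarrow>
     U \<subseteq> {0..1} \<and> (\<exists>V. openin (top_of_set {0..1}) V \<and> x \<in> V \<and> V \<subseteq> U)"

definition uniform_lip :: "real \<Rightarrow> (real \<Rightarrow> 'a::real_normed_field) \<Rightarrow> real set \<Rightarrow> bool" where
  "uniform_lip \<alpha> h U \<longleftrightarrow>
     (holder_quotient \<alpha> h \<longlongrightarrow> 0) ((\<lambda>(u, v). \<bar>u - v\<bar>) going_to (nhds 0) within (off_diag U))"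

definition noncritical_point :: "real \<Rightarrow> (real \<Rightarrow> 'a::real_normed_field) \<Rightarrow> real \<Rightarrow> bool" where
  "noncritical_point \<alpha> h x \<longleftrightarrow> (\<exists>U. nhd_unit x U \<and> uniform_lip \<alpha> h U)"

definition critical_points :: "real \<Rightarrow> (real \<Rightarrow> 'a::real_normed_field) \<Rightarrow> real set" where
  "critical_points \<alpha> h = {x \<in> {0..1}. \<not> noncritical_point \<alpha> h x}"

definition holder_p :: "real \<Rightarrow> (real \<Rightarrow> 'a::real_normed_field) set" where
  "holder_p \<alpha> = {h \<in> holder_space \<alpha>. finite (critical_points \<alpha> h)}"

definition holder_omega :: "real \<Rightarrow> (real \<Rightarrow> 'a::real_normed_field) set" where
  "holder_omega \<alpha> = {h \<in> holder_space \<alpha>. \<forall>\<epsilon>::real. \<epsilon> > 0 \<longrightarrow>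
     (\<exists>F. finite F \<and> F \<subseteq> {0..1} \<and>
        (\<forall>x \<in> {0..1} - F. \<exists>U. nhd_unit x U \<and> holder_sup \<alpha> U h \<le> ennreal \<epsilon>))}"

lemma uniform_lip_iff:
  "uniform_lip \<alpha> h U \<longleftrightarrow>
     (\<forall>\<epsilon>>0. \<exists>\<delta>>0. \<forall>u\<in>U. \<forall>v\<in>U. u \<noteq> v \<and> \<bar>u - v\<bar> < \<delta> \<longrightarrow>
        norm (h u - h v) / \<bar>u - v\<bar> powr \<alpha> < \<epsilon>)"
proof -
  have eq: "(\<exists>P. (\<exists>\<delta>>0. \<forall>t. \<bar>t\<bar> < \<delta> \<longrightarrow> P t) \<and> (\<forall>u v. P \<bar>u - v\<bar> \<longrightarrow> Q u v))
      \<longleftrightarrow> (\<exists>\<delta>>0. \<forall>u v. \<bar>u - v\<bar> < \<delta> \<longrightarrow> Q u v)" (is "?L \<longleftrightarrow> ?R")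
    for Q :: "real \<Rightarrow> real \<Rightarrow> bool"
  proof
    assume ?L
    then obtain P \<delta> where P: "\<delta> > 0" "\<And>t. \<bar>t\<bar> < \<delta> \<Longrightarrow> P t" "\<And>u v. P \<bar>u - v\<bar> \<Longrightarrow> Q u v"
      by blast
    then have "Q u v" if "\<bar>u - v\<bar> < \<delta>" for u v
      using that by (intro P(3) P(2)) simp
    with P(1) show ?R by blast
  next
    assume ?R
    then obtain \<delta> where "\<delta> > 0" "\<And>u v. \<bar>u - v\<bar> < \<delta> \<Longrightarrow> Q u v" by blast
    then show ?L by (intro exI[of _ "\<lambda>t. \<bar>t\<bar> < \<delta>"]) auto
  qed
  have "uniform_lip \<alpha> h U \<longleftrightarrow> (\<forall>\<epsilon>>0. \<exists>P. (\<exists>\<delta>>0. \<forall>t. \<bar>t\<bar> < \<delta> \<longrightarrow> P t) \<and>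
     (\<forall>u v. P \<bar>u - v\<bar> \<longrightarrow> u \<in> U \<and> v \<in> U \<and> u \<noteq> v \<longrightarrow>
        norm (h u - h v) / \<bar>u - v\<bar> powr \<alpha> < \<epsilon>))"
    unfolding uniform_lip_def tendsto_iff going_to_within_def eventually_inf_principal
      eventually_filtercomap eventually_nhds_metric
    by (simp add: off_diag_def holder_quotient_def split_paired_all dist_real_def)
  also have "\<dots> \<longleftrightarrow> (\<forall>\<epsilon>>0. \<exists>\<delta>>0. \<forall>u v. \<bar>u - v\<bar> < \<delta> \<longrightarrow> u \<in> U \<and> v \<in> U \<and> u \<noteq> v \<longrightarrow>
        norm (h u - h v) / \<bar>u - v\<bar> powr \<alpha> < \<epsilon>)"
    by (subst eq) (rule refl)
  finally show ?thesis
    by (simp add: Ball_def imp_conjL) (meson)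
qed

lemma holder_sup_triangle:
  "holder_sup \<alpha> U (\<lambda>x. f x + g x) \<le> holder_sup \<alpha> U f + holder_sup \<alpha> U g"
  unfolding holder_sup_def
proof (rule SUP_least)
  fix p assume p: "p \<in> off_diag U"
  obtain x y where xy: "p = (x, y)" by (cases p)
  have "norm ((f x + g x) - (f y + g y)) \<le> norm (f x - f y) + norm (g x - g y)"
    by (metis add_diff_add norm_triangle_ineq)
  then have "holder_quotient \<alpha> (\<lambda>x. f x + g x) p \<le> holder_quotient \<alpha> f p + holder_quotient \<alpha> g p"
    by (simp add: holder_quotient_def xy divide_right_mono flip: add_divide_distrib)
  then have "ennreal (holder_quotient \<alpha> (\<lambda>x. f x + g x) p)
      \<le> ennreal (holder_quotient \<alpha> f p) + ennreal (holder_quotient \<alpha> g p)"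
    by (simp add: holder_quotient_def xy ennreal_leI flip: ennreal_plus)
  also have "\<dots> \<le> (SUP p\<in>off_diag U. ennreal (holder_quotient \<alpha> f p))
      + (SUP p\<in>off_diag U. ennreal (holder_quotient \<alpha> g p))"
    using p by (intro add_mono SUP_upper)
  finally show "ennreal (holder_quotient \<alpha> (\<lambda>x. f x + g x) p) \<le> \<dots>" .
qed

lemma holder_sup_minus_commute:
  "holder_sup \<alpha> U (\<lambda>x. f x - g x) = holder_sup \<alpha> U (\<lambda>x. g x - f x)"
proof -
  have "norm (f x - g x - (f y - g y)) = norm (g x - f x - (g y - f y))" for x y
    
    using norm_minus_commute[of "f x - g x" "f y - g y"] by (simp add: algebra_simps)
  then show ?thesis by (simp add: holder_sup_def holder_quotient_def)
qed

lemma holder_sup_uminus: "holder_sup \<alpha> U (\<lambda>x. - f x) = holder_sup \<alpha> U f"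
  using holder_sup_minus_commute[of \<alpha> U "\<lambda>_. 0" f] by simp

lemma holder_space_diff:
  assumes "f \<in> holder_space \<alpha>" "g \<in> holder_space \<alpha>"
  shows "(\<lambda>x. f x - g x) \<in> holder_space \<alpha>"
proof -
  have "holder_sup \<alpha> {0..1} (\<lambda>x. f x - g x) \<le> holder_sup \<alpha> {0..1} f + holder_sup \<alpha> {0..1} g"
    using holder_sup_triangle[of \<alpha> "{0..1}" f "\<lambda>x. - g x"] by (simp add: holder_sup_uminus)
  also have "\<dots> < \<infinity>"
    using assms by (simp add: holder_space_def)
  finally show ?thesis
    using assms by (simp add: holder_space_def)
qed

lemma holder_norm_eq_0_iff:
  assumes "f \<in> holder_space \<alpha>"
  shows "holder_norm \<alpha> f = 0 \<longleftrightarrow> f = (\<lambda>x. 0)"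
proof
  assume "holder_norm \<alpha> f = 0"
  with assms have 0: "holder_sup \<alpha> {0..1} f = 0"
    by (auto simp: holder_norm_def holder_space_def enn2real_eq_0_iff)
  have "f x = 0" for x
  proof (cases "x \<in> {0..1} \<and> x \<noteq> 0")
    case True
    then have "ennreal (holder_quotient \<alpha> f (x, 0)) \<le> holder_sup \<alpha> {0..1} f"
      unfolding holder_sup_def by (intro SUP_upper) (auto simp: off_diag_def)
    with 0 True assms show ?thesis
      by (auto simp: holder_quotient_def holder_space_def ennreal_eq_0_iff divide_le_0_iff)
  qed (use assms in \<open>auto simp: holder_space_def\<close>)
  then show "f = (\<lambda>x. 0)" by auto
next
  assume "f = (\<lambda>x. 0)"
  then have "holder_sup \<alpha> {0..1} f \<le> 0"
    unfolding holder_sup_def by (intro SUP_least) (auto simp: holder_quotient_def)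
  then show "holder_norm \<alpha> f = 0"
    by (simp add: holder_norm_def)
qed

lemma Metric_space_holder: "Metric_space (holder_space \<alpha>) (holder_dist \<alpha>)"
proof
  fix f g h :: "real \<Rightarrow> 'a"
  show "0 \<le> holder_dist \<alpha> f g"
    by (simp add: holder_dist_def holder_norm_def)
  show "holder_dist \<alpha> f g = holder_dist \<alpha> g f"
    by (simp add: holder_dist_def holder_norm_def holder_sup_minus_commute[of \<alpha> _ f])
  assume f: "f \<in> holder_space \<alpha>" and g: "g \<in> holder_space \<alpha>"
  show "holder_dist \<alpha> f g = 0 \<longleftrightarrow> f = g"
    using holder_norm_eq_0_iff[OF holder_space_diff[OF f g]]
    by (auto simp: holder_dist_def fun_eq_iff)
  assume h: "h \<in> holder_space \<alpha>"
  have "holder_sup \<alpha> {0..1} (\<lambda>x. f x - h x)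
      \<le> holder_sup \<alpha> {0..1} (\<lambda>x. f x - g x) + holder_sup \<alpha> {0..1} (\<lambda>x. g x - h x)"
    using holder_sup_triangle[of \<alpha> "{0..1}" "\<lambda>x. f x - g x" "\<lambda>x. g x - h x"] by simp
  moreover have "holder_sup \<alpha> {0..1} (\<lambda>x. f x - g x) < \<infinity>" "holder_sup \<alpha> {0..1} (\<lambda>x. g x - h x) < \<infinity>"
    using holder_space_diff[OF f g] holder_space_diff[OF g h] by (auto simp: holder_space_def)
  ultimately show "holder_dist \<alpha> f h \<le> holder_dist \<alpha> f g + holder_dist \<alpha> g h"
    unfolding holder_dist_def holder_norm_def
    by (subst enn2real_plus[symmetric]) (auto intro!: enn2real_mono simp: less_top)
qed

end

theory Submission
  imports Defs
begin

text \<open>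
  Lipschitz functions satisfy the uniform lip-condition because \<open>\<alpha> < 1\<close>. This is the source of
  all functions in \<open>H\<^sub>\<alpha>\<^sup>p\<close> that are constructed below: given \<open>h\<close> in \<open>H\<^sub>\<alpha>\<^sup>\<omega>\<close> and \<open>\<epsilon> > 0\<close>, remove the
  finite exceptional set \<open>F\<close> and cut the rest of \<open>[0,1]\<close> into countably many closed intervals on
  each of which \<open>h\<close> has Hoelder constant at most \<open>\<epsilon>\<close>. Near a point of \<open>F\<close> these intervals
  necessarily accumulate. Let \<open>g\<close> be the function that interpolates \<open>h\<close> linearly
  between the nodes and equals \<open>h\<close> on \<open>F\<close>. It is locally Lipschitz away from a
  finite set, so it has finitely many critical points.

  The difference \<open>d = h - g\<close> vanishes at every node and has Hoelder constant at most \<open>2 * \<epsilon>\<close> on each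
  interval between neighbouring nodes. For points \<open>x\<close> and \<open>y\<close> in different
  intervals, \<open>d x\<close> and \<open>d y\<close> are compared with zeros of \<open>d\<close> that lie between \<open>x\<close> and \<open>y\<close>, which
  gives the global Hoelder constant \<open>4 * \<epsilon>\<close>, no matter how many nodes there are. That the
  constant survives the gluing of arbitrarily many intervals is the point of the proof; the
  predicate \<open>pinned_holder\<close> isolates a property of \<open>d\<close> that is preserved exactly under
  gluing. The nodes themselves are never named globally: compact intervals free of exceptional
  points are treated by bisection (\<open>lipschitz_approximation\<close>), a countable chain of these
  leads up to an exceptional point (\<open>locally_lipschitz_approximation\<close>), and a second bisection
  treats finitely many exceptional points (\<open>piecewise_locally_lipschitz_approximation\<close>).

  Conversely, if \<open>h\<close> is within \<open>\<epsilon>/2\<close> of a function \<open>g\<close> in \<open>H\<^sub>\<alpha>\<^sup>p\<close>, then every noncritical point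
  of \<open>g\<close> has a neighbourhood on which \<open>g\<close> has Hoelder constant at most \<open>\<epsilon>/2\<close>, and so \<open>h\<close>
  has constant at most \<open>\<epsilon>\<close> there. The critical points of \<open>g\<close> form the required finite set.
\<close>

section \<open>Hoelder bounds on sets\<close>

definition holder_on :: "real \<Rightarrow> real \<Rightarrow> real set \<Rightarrow> (real \<Rightarrow> 'a::real_normed_vector) \<Rightarrow> bool" where
  "holder_on \<alpha> c S f \<longleftrightarrow> (\<forall>x\<in>S. \<forall>y\<in>S. norm (f x - f y) \<le> c * \<bar>x - y\<bar> powr \<alpha>)"

lemma holder_onD:
  "holder_on \<alpha> c S f \<Longrightarrow> x \<in> S \<Longrightarrow> y \<in> S \<Longrightarrow> norm (f x - f y) \<le> c * \<bar>x - y\<bar> powr \<alpha>"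
  by (simp add: holder_on_def)

lemma holder_on_subset: "holder_on \<alpha> c S f \<Longrightarrow> T \<subseteq> S \<Longrightarrow> holder_on \<alpha> c T f"
  by (auto simp: holder_on_def)

lemma holder_on_diff:
  assumes "holder_on \<alpha> c S f" "holder_on \<alpha> c' S g"
  shows "holder_on \<alpha> (c + c') S (\<lambda>x. f x - g x)"
  unfolding holder_on_def
proof (intro ballI)
  fix x y assume xy: "x \<in> S" "y \<in> S"
  have "norm ((f x - g x) - (f y - g y)) = norm ((f x - f y) - (g x - g y))"
    by (simp add: algebra_simps)
  also have "\<dots> \<le> norm (f x - f y) + norm (g x - g y)"
    by (rule norm_triangle_ineq4)
  also have "\<dots> \<le> (c + c') * \<bar>x - y\<bar> powr \<alpha>"
    using assms xy by (auto simp: holder_on_def distrib_right intro!: add_mono)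
  finally show "norm ((f x - g x) - (f y - g y)) \<le> (c + c') * \<bar>x - y\<bar> powr \<alpha>" .
qed

lemma holder_on_reflect:
  "holder_on \<alpha> c S f \<Longrightarrow> holder_on \<alpha> c (uminus ` S) (\<lambda>x. f (- x))"
  by (auto simp: holder_on_def abs_minus_commute)

lemma holder_sup_le_iff:
  assumes "0 \<le> c"
  shows "holder_sup \<alpha> U f \<le> ennreal c \<longleftrightarrow> holder_on \<alpha> c U f"
proof -
  have "norm (f x - f y) / \<bar>x - y\<bar> powr \<alpha> \<le> c \<longleftrightarrow> norm (f x - f y) \<le> c * \<bar>x - y\<bar> powr \<alpha>"
    if "x \<noteq> y" for x y
    using that by (simp add: pos_divide_le_eq)
  then show ?thesis
    using assms
    by (auto simp: holder_sup_def SUP_le_iff off_diag_def holder_quotient_def holder_on_def) force+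
qed

section \<open>Functions that are Hoelder continuous between their zeros\<close>

text \<open>
  The second alternative is what zeros of \<open>d\<close> between \<open>x\<close> and \<open>y\<close> provide. In contrast to the
  Hoelder condition, this dichotomy passes to a union of adjacent intervals with the same
  constant, so it can be used in inductions of any length; it costs only a factor of \<open>2\<close> once, when
  the Hoelder condition is recovered from it.
\<close>

definition pinned_holder ::
    "real \<Rightarrow> real \<Rightarrow> real \<Rightarrow> real \<Rightarrow> (real \<Rightarrow> 'a::real_normed_vector) \<Rightarrow> bool" where
  "pinned_holder \<alpha> c a b d \<longleftrightarrow> d a = 0 \<and> d b = 0 \<and>
     (\<forall>x\<in>{a..b}. \<forall>y\<in>{a..b}. norm (d x - d y) \<le> c * \<bar>x - y\<bar> powr \<alpha> \<or>
        (norm (d x) \<le> c * \<bar>x - y\<bar> powr \<alpha> \<and> norm (d y) \<le> c * \<bar>x - y\<bar> powr \<alpha>))"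

lemma pinned_holderI:
  assumes "d a = 0" "d b = 0"
    and "\<And>x y. a \<le> x \<Longrightarrow> x < y \<Longrightarrow> y \<le> b \<Longrightarrow> norm (d x - d y) \<le> c * (y - x) powr \<alpha> \<or>
        (norm (d x) \<le> c * (y - x) powr \<alpha> \<and> norm (d y) \<le> c * (y - x) powr \<alpha>)"
  shows "pinned_holder \<alpha> c a b d"
  unfolding pinned_holder_def
proof (intro conjI ballI assms(1,2))
  fix x y assume xy: "x \<in> {a..b}" "y \<in> {a..b}"
  consider "x < y" | "x = y" | "y < x" by linarith
  then show "norm (d x - d y) \<le> c * \<bar>x - y\<bar> powr \<alpha> \<or>
      (norm (d x) \<le> c * \<bar>x - y\<bar> powr \<alpha> \<and> norm (d y) \<le> c * \<bar>x - y\<bar> powr \<alpha>)"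
  proof cases
    case 1
    then show ?thesis using assms(3)[of x y] xy by auto
  next
    case 2
    then show ?thesis by simp
  next
    case 3
    then show ?thesis using assms(3)[of y x] xy by (auto simp: norm_minus_commute)
  qed
qed

lemma pinned_holderD:
  assumes "pinned_holder \<alpha> c a b d" "a \<le> x" "x < y" "y \<le> b"
  shows "norm (d x - d y) \<le> c * (y - x) powr \<alpha> \<or>
        (norm (d x) \<le> c * (y - x) powr \<alpha> \<and> norm (d y) \<le> c * (y - x) powr \<alpha>)"
proof -
  have "x \<in> {a..b}" "y \<in> {a..b}" "\<bar>x - y\<bar> = y - x" using assms(2-4) by auto
  then show ?thesis using assms(1) unfolding pinned_holder_def by metis
qed

lemma pinned_holder_left_end:
  assumes "pinned_holder \<alpha> c a b d" "a < x" "x \<le> b"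
  shows "norm (d x) \<le> c * (x - a) powr \<alpha>"
  using pinned_holderD[of \<alpha> c a b d a x] assms by (auto simp: pinned_holder_def)

lemma pinned_holder_right_end:
  assumes "pinned_holder \<alpha> c a b d" "a \<le> x" "x < b"
  shows "norm (d x) \<le> c * (b - x) powr \<alpha>"
  using pinned_holderD[of \<alpha> c a b d x b] assms by (auto simp: pinned_holder_def)

lemma pinned_holder_cong:
  assumes "pinned_holder \<alpha> c a b d" "a \<le> b" "\<And>x. x \<in> {a..b} \<Longrightarrow> d' x = d x"
  shows "pinned_holder \<alpha> c a b d'"
  using assms by (simp add: pinned_holder_def)

lemma pinned_holder_reflect:
  assumes "pinned_holder \<alpha> c a b d"
  shows "pinned_holder \<alpha> c (- b) (- a) (\<lambda>x. d (- x))"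
proof (rule pinned_holderI)
  fix x y :: real assume xy: "- b \<le> x" "x < y" "y \<le> - a"
  show "norm (d (- x) - d (- y)) \<le> c * (y - x) powr \<alpha> \<or>
        (norm (d (- x)) \<le> c * (y - x) powr \<alpha> \<and> norm (d (- y)) \<le> c * (y - x) powr \<alpha>)"
    using pinned_holderD[OF assms, of "- y" "- x"] xy by (auto simp: norm_minus_commute)
qed (use assms in \<open>auto simp: pinned_holder_def\<close>)

text \<open>
  If the common end point \<open>b\<close> separates \<open>x\<close> from \<open>y\<close>, then \<open>d x\<close> and \<open>d y\<close> are each compared with
  \<open>d b = 0\<close>. The resulting bounds fall under the second alternative, with the constant \<open>c\<close>.
\<close>

lemma pinned_holder_glue:
  assumes ab: "pinned_holder \<alpha> c a b d" and bc: "pinned_holder \<alpha> c b e d"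
    and "0 < \<alpha>" "0 \<le> c"
  shows "pinned_holder \<alpha> c a e d"
proof (rule pinned_holderI)
  fix x y assume xy: "a \<le> x" "x < y" "y \<le> e"
  consider "y \<le> b" | "b \<le> x" | "x < b" "b < y" by linarith
  then show "norm (d x - d y) \<le> c * (y - x) powr \<alpha> \<or>
      (norm (d x) \<le> c * (y - x) powr \<alpha> \<and> norm (d y) \<le> c * (y - x) powr \<alpha>)"
  proof cases
    case 1
    then show ?thesis using pinned_holderD[OF ab] xy by auto
  next
    case 2
    then show ?thesis using pinned_holderD[OF bc] xy by auto
  next
    case 3
    have "norm (d x) \<le> c * (b - x) powr \<alpha>" "norm (d y) \<le> c * (y - b) powr \<alpha>"
      using pinned_holder_right_end[OF ab] pinned_holder_left_end[OF bc] xy 3 by auto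
    moreover have "c * (b - x) powr \<alpha> \<le> c * (y - x) powr \<alpha>" "c * (y - b) powr \<alpha> \<le> c * (y - x) powr \<alpha>"
      using 3 \<open>0 < \<alpha>\<close> \<open>0 \<le> c\<close> by (auto intro!: mult_left_mono powr_mono2)
    ultimately show ?thesis by linarith
  qed
qed (use ab bc in \<open>auto simp: pinned_holder_def\<close>)

lemma pinned_holder_glue_if:
  assumes "pinned_holder \<alpha> c a b (\<lambda>x. h x - g x)" "pinned_holder \<alpha> c b e (\<lambda>x. h x - g' x)"
    and "a \<le> b" "b \<le> e" "0 < \<alpha>" "0 \<le> c"
  shows "pinned_holder \<alpha> c a e (\<lambda>x. h x - (if x \<le> b then g x else g' x))"
proof (rule pinned_holder_glue[OF _ _ assms(5,6)])
  show "pinned_holder \<alpha> c a b (\<lambda>x. h x - (if x \<le> b then g x else g' x))"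
    by (rule pinned_holder_cong[OF assms(1,3)]) auto
  show "pinned_holder \<alpha> c b e (\<lambda>x. h x - (if x \<le> b then g x else g' x))"
    by (rule pinned_holder_cong[OF assms(2,4)]) (use assms(1,2) in \<open>auto simp: pinned_holder_def\<close>)
qed

lemma pinned_holder_imp_holder_on:
  assumes "pinned_holder \<alpha> c a b d" "0 \<le> c"
  shows "holder_on \<alpha> (2 * c) {a..b} d"
  unfolding holder_on_def
proof (intro ballI)
  fix x y assume xy: "x \<in> {a..b}" "y \<in> {a..b}"
  define r where "r = c * \<bar>x - y\<bar> powr \<alpha>"
  have "norm (d x - d y) \<le> norm (d x) + norm (d y)"
    by (rule norm_triangle_ineq4)
  moreover have "0 \<le> r"
    using \<open>0 \<le> c\<close> by (simp add: r_def)
  moreover have "norm (d x - d y) \<le> r \<or> (norm (d x) \<le> r \<and> norm (d y) \<le> r)"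
    using assms(1) xy unfolding pinned_holder_def r_def by blast
  ultimately have "norm (d x - d y) \<le> 2 * r" by linarith
  then show "norm (d x - d y) \<le> 2 * c * \<bar>x - y\<bar> powr \<alpha>" by (simp add: r_def)
qed

section \<open>Approximation away from exceptional points\<close>

text \<open>
  The slope of the chord over an interval of length \<open>l\<close> is at most \<open>\<epsilon> * l powr (\<alpha> - 1)\<close> in norm. As
  \<open>\<alpha> < 1\<close>, this bound only grows when \<open>l\<close> is replaced by a smaller distance, so the chord is
  again Hoelder with constant \<open>\<epsilon>\<close>, and the difference with constant \<open>2 * \<epsilon>\<close>.
\<close>

lemma linear_interpolation:
  fixes h :: "real \<Rightarrow> 'a::real_normed_vector"
  assumes "\<alpha> < 1" "a < b" and h: "holder_on \<alpha> \<epsilon> {a..b} h"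
  obtains g C where "pinned_holder \<alpha> (2 * \<epsilon>) a b (\<lambda>x. h x - g x)" "C-lipschitz_on {a..b} g"
proof -
  define s where "s = (1 / (b - a)) *\<^sub>R (h b - h a)"
  define g where "g x = h a + (x - a) *\<^sub>R s" for x
  have g_diff: "norm (g x - g y) = \<bar>x - y\<bar> * norm s" for x y
  proof -
    have "g x - g y = (x - y) *\<^sub>R s" by (simp add: g_def algebra_simps)
    then show ?thesis by simp
  qed
  have "norm (h b - h a) \<le> \<epsilon> * (b - a) powr \<alpha>"
    using holder_onD[OF h, of b a] \<open>a < b\<close> by auto
  then have "norm s \<le> \<epsilon> * (b - a) powr \<alpha> / (b - a)"
    using \<open>a < b\<close> by (simp add: s_def divide_right_mono)
  then have s: "norm s \<le> \<epsilon> * (b - a) powr (\<alpha> - 1)"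
    using \<open>a < b\<close> by (simp add: powr_diff)
  have "0 \<le> \<epsilon> * (b - a) powr (\<alpha> - 1)"
    using s norm_ge_zero order_trans by blast
  then have "0 \<le> \<epsilon>"
    using \<open>a < b\<close> by (simp add: zero_le_mult_iff)
  have "holder_on \<alpha> \<epsilon> {a..b} g"
    unfolding holder_on_def
  proof (intro ballI)
    fix x y assume xy: "x \<in> {a..b}" "y \<in> {a..b}"
    show "norm (g x - g y) \<le> \<epsilon> * \<bar>x - y\<bar> powr \<alpha>"
    proof (cases "x = y")
      case False
      have "(b - a) powr (\<alpha> - 1) \<le> \<bar>x - y\<bar> powr (\<alpha> - 1)"
        using False xy \<open>\<alpha> < 1\<close> by (intro powr_mono2') auto
      then have "norm s \<le> \<epsilon> * \<bar>x - y\<bar> powr (\<alpha> - 1)"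
        using s \<open>0 \<le> \<epsilon>\<close> mult_left_mono order_trans by blast
      then have "\<bar>x - y\<bar> * norm s \<le> \<bar>x - y\<bar> * (\<epsilon> * \<bar>x - y\<bar> powr (\<alpha> - 1))"
        by (simp add: mult_left_mono)
      also have "\<dots> = \<epsilon> * \<bar>x - y\<bar> powr \<alpha>"
        using False by (simp add: powr_diff)
      finally show ?thesis by (simp add: g_diff)
    qed simp
  qed
  then have d: "holder_on \<alpha> (2 * \<epsilon>) {a..b} (\<lambda>x. h x - g x)"
    using holder_on_diff[OF h] by fastforce
  have "pinned_holder \<alpha> (2 * \<epsilon>) a b (\<lambda>x. h x - g x)"
    using d \<open>a < b\<close> by (auto simp: pinned_holder_def holder_on_def g_def s_def)
  moreover have "(norm s)-lipschitz_on {a..b} g"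
    by (rule lipschitz_onI) (simp_all add: dist_norm g_diff mult.commute)
  ultimately show thesis by (rule that)
qed

lemma pinned_holder_refl: "0 < \<alpha> \<Longrightarrow> d a = 0 \<Longrightarrow> pinned_holder \<alpha> c a a d"
  by (simp add: pinned_holder_def)

text \<open>
  By compactness finitely many interpolations suffice, and a maximum of finitely many Lipschitz
  constants is a Lipschitz constant for the result. Its size is of no interest: only the constant
  \<open>2 * \<epsilon>\<close> has to be independent of the number of pieces.
\<close>

lemma lipschitz_approximation:
  fixes h :: "real \<Rightarrow> 'a::real_normed_vector"
  assumes "0 < \<alpha>" "\<alpha> < 1" "0 \<le> \<epsilon>" "a \<le> b"
    and loc: "\<And>x. x \<in> {a..b} \<Longrightarrow> \<exists>\<delta>>0. holder_on \<alpha> \<epsilon> ({x - \<delta><..<x + \<delta>} \<inter> {a..b}) h"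
  shows "\<exists>g C. pinned_holder \<alpha> (2 * \<epsilon>) a b (\<lambda>x. h x - g x) \<and> C-lipschitz_on {a..b} g"
proof -
  have "a \<le> a \<and> b \<le> b \<longrightarrow>
      (\<exists>g C. pinned_holder \<alpha> (2 * \<epsilon>) a b (\<lambda>x. h x - g x) \<and> C-lipschitz_on {a..b} g)"
    using \<open>a \<le> b\<close>
  \<comment> \<open>Bisection: the bounds relative to the original interval only keep the subintervals inside it.\<close>
  proof (induction rule: Bolzano[where P = "\<lambda>u v. a \<le> u \<and> v \<le> b \<longrightarrow>
      (\<exists>g C. pinned_holder \<alpha> (2 * \<epsilon>) u v (\<lambda>x. h x - g x) \<and> C-lipschitz_on {u..v} g)"])
    case (trans u v w)
    show ?case
    proof
      assume uw: "a \<le> u \<and> w \<le> b"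
      obtain g C where g: "pinned_holder \<alpha> (2 * \<epsilon>) u v (\<lambda>x. h x - g x)" "C-lipschitz_on {u..v} g"
        using trans uw by fastforce
      obtain g' C' where g': "pinned_holder \<alpha> (2 * \<epsilon>) v w (\<lambda>x. h x - g' x)" "C'-lipschitz_on {v..w} g'"
        using trans uw by fastforce
      have "g v = g' v"
        using g(1) g'(1) by (simp add: pinned_holder_def)
      then show "\<exists>g C. pinned_holder \<alpha> (2 * \<epsilon>) u w (\<lambda>x. h x - g x) \<and> C-lipschitz_on {u..w} g"
        using pinned_holder_glue_if[OF g(1) g'(1)] lipschitz_on_concat_max[OF g(2) g'(2)] trans assms(1,3)
        by fastforce
    qed
  next
    case (local x)
    then obtain \<delta> where \<delta>: "\<delta> > 0" "holder_on \<alpha> \<epsilon> ({x - \<delta><..<x + \<delta>} \<inter> {a..b}) h"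
      using loc[of x] by auto
    have "\<exists>g C. pinned_holder \<alpha> (2 * \<epsilon>) u v (\<lambda>x. h x - g x) \<and> C-lipschitz_on {u..v} g"
      if uv: "u \<le> x" "x \<le> v" "v - u < \<delta>" "a \<le> u" "v \<le> b" for u v
    proof (cases "u = v")
      case True
      then show ?thesis
        using pinned_holder_refl[of \<alpha> "\<lambda>x. h x - h x"] lipschitz_on_singleton[of 0] \<open>0 < \<alpha>\<close>
        by (intro exI[of _ h] exI[of _ 0]) auto
    next
      case False
      have "holder_on \<alpha> \<epsilon> {u..v} h"
        using uv by (intro holder_on_subset[OF \<delta>(2)]) auto
      then show ?thesis
        using linear_interpolation[OF \<open>\<alpha> < 1\<close>, of u v \<epsilon> h] uv False by force
    qed
    with \<delta>(1) show ?case by blast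
  qed
  then show ?thesis by simp
qed

section \<open>Approximation up to an exceptional point\<close>

text \<open>
  Here \<open>h\<close> may have large Hoelder quotients arbitrarily close to \<open>p\<close>. Choose nodes \<open>t n\<close> that
  increase from \<open>a\<close> to \<open>p\<close>, approximate on each \<open>[t n, t (n + 1)]\<close> and glue. Gluing keeps
  the constant on every \<open>[a, t n]\<close>, while the Lipschitz constant may tend to infinity. At \<open>p\<close>
  the bound comes for free: \<open>x < p\<close> has a node \<open>t n\<close> between itself and \<open>p\<close>, where the
  difference vanishes just as at \<open>p\<close>.
\<close>

lemma locally_lipschitz_approximation:
  fixes h :: "real \<Rightarrow> 'a::real_normed_vector"
  assumes "0 < \<alpha>" "\<alpha> < 1" "0 \<le> \<epsilon>" "a < p"
    and loc: "\<And>x. x \<in> {a..<p} \<Longrightarrow> \<exists>\<delta>>0. holder_on \<alpha> \<epsilon> ({x - \<delta><..<x + \<delta>} \<inter> {a..p}) h"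
  shows "\<exists>g. pinned_holder \<alpha> (2 * \<epsilon>) a p (\<lambda>x. h x - g x) \<and>
     (\<forall>x. a \<le> x \<and> x < p \<longrightarrow> (\<exists>C. C-lipschitz_on {a..x} g))"
proof -
  define t where "t n = p - (p - a) / real (Suc n)" for n
  have t0: "t 0 = a" by (simp add: t_def)
  have t_p: "t n < p" for n
    using \<open>a < p\<close> by (simp add: t_def)
  have t_mono: "t m \<le> t n" if "m \<le> n" for m n
    using that \<open>a < p\<close> by (simp add: t_def frac_le)
  have t_less: "t n < t (Suc n)" for n
    using \<open>a < p\<close> unfolding t_def by (simp add: divide_strict_left_mono)
  have t_a: "a \<le> t n" for n
    using t_mono[of 0 n] t0 by simp
  have t_conv: "\<exists>n. x < t n" if "x < p" for x
  proof -
    obtain n where n: "(p - a) / (p - x) < real n"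
      using reals_Archimedean2 by blast
    then have "(p - a) / (p - x) < real (Suc n)" by simp
    then have "(p - a) / real (Suc n) < p - x"
      using \<open>x < p\<close> by (simp add: field_simps del: of_nat_Suc)
    then show ?thesis by (auto simp: t_def intro!: exI[of _ n])
  qed
  have "\<exists>g C. pinned_holder \<alpha> (2 * \<epsilon>) (t n) (t (Suc n)) (\<lambda>x. h x - g x) \<and>
      C-lipschitz_on {t n..t (Suc n)} g" for n
  proof (rule lipschitz_approximation[OF assms(1-3)])
    show "t n \<le> t (Suc n)" using t_less[of n] by simp
    fix x assume x: "x \<in> {t n..t (Suc n)}"
    then obtain \<delta> where "\<delta> > 0" "holder_on \<alpha> \<epsilon> ({x - \<delta><..<x + \<delta>} \<inter> {a..p}) h"
      using loc[of x] t_a[of n] t_p[of "Suc n"] by auto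
    moreover have "{t n..t (Suc n)} \<subseteq> {a..p}"
      using t_a[of n] t_p[of "Suc n"] by auto
    ultimately show "\<exists>\<delta>>0. holder_on \<alpha> \<epsilon> ({x - \<delta><..<x + \<delta>} \<inter> {t n..t (Suc n)}) h"
      by (meson holder_on_subset inf_mono order_refl)
  qed
  then obtain G C where
    G: "\<And>n. pinned_holder \<alpha> (2 * \<epsilon>) (t n) (t (Suc n)) (\<lambda>x. h x - G n x)"
       "\<And>n. (C n)-lipschitz_on {t n..t (Suc n)} (G n)"
    by metis
  define g where "g x = (if x < p then G (LEAST n. x \<le> t (Suc n)) x else h x)" for x
  have g_eq: "g x = G n x" if x: "x \<in> {t n..t (Suc n)}" for n x
  proof -
    have "x < p" using x t_p[of "Suc n"] by auto
    show ?thesis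
    proof (cases "x = t n \<and> n > 0")
      case True
      \<comment> \<open>A node belongs to two intervals; both pieces agree with \<open>h\<close> there.\<close>
      then obtain m where m: "n = Suc m" by (cases n) auto
      have "(LEAST k. x \<le> t (Suc k)) = m"
      proof (rule Least_equality)
        fix k assume "x \<le> t (Suc k)"
        then show "m \<le> k"
          using True m t_less[of "Suc k"] t_mono[of "Suc (Suc k)" n] by (cases "m \<le> k") auto
      qed (use True m in auto)
      moreover have "G m (t n) = h (t n)" "G n (t n) = h (t n)"
        using G(1)[of m] G(1)[of n] m by (simp_all add: pinned_holder_def)
      ultimately show ?thesis using \<open>x < p\<close> True by (simp add: g_def)
    next
      case False
      have "(LEAST k. x \<le> t (Suc k)) = n"
      proof (rule Least_equality)
        fix k assume k: "x \<le> t (Suc k)"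
        show "n \<le> k"
        proof (rule ccontr)
          assume "\<not> n \<le> k"
          then have "n > 0" "t (Suc k) \<le> t n" by (auto intro: t_mono)
          with k x False show False by auto
        qed
      qed (use x in auto)
      then show ?thesis using \<open>x < p\<close> by (simp add: g_def)
    qed
  qed
  have pieces: "pinned_holder \<alpha> (2 * \<epsilon>) a (t n) (\<lambda>x. h x - g x) \<and> (\<exists>C. C-lipschitz_on {a..t n} g)" for n
  proof (induction n)
    case 0
    have "g a = G 0 a" "G 0 a = h a"
      using g_eq[of a 0] t0 t_less[of 0] G(1)[of 0] by (auto simp: pinned_holder_def)
    then show ?case
      using \<open>0 < \<alpha>\<close> lipschitz_on_singleton[of 0 a g] by (auto simp: t0 intro!: pinned_holder_refl)
  next
    case (Suc n)
    then obtain B where B: "B-lipschitz_on {a..t n} g" by blast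
    have "(C n)-lipschitz_on {t n..t (Suc n)} g"
      using lipschitz_on_transform[OF G(2)[of n]] g_eq[of _ n] by simp
    from lipschitz_on_concat_max[OF B this]
    have "(max B (C n))-lipschitz_on {a..t (Suc n)} g" by simp
    moreover have "pinned_holder \<alpha> (2 * \<epsilon>) (t n) (t (Suc n)) (\<lambda>x. h x - g x)"
      by (rule pinned_holder_cong[OF G(1)]) (use t_less[of n] g_eq[of _ n] in auto)
    then have "pinned_holder \<alpha> (2 * \<epsilon>) a (t (Suc n)) (\<lambda>x. h x - g x)"
      using Suc assms(1,3) pinned_holder_glue[of \<alpha> "2 * \<epsilon>" a "t n"] by auto
    ultimately show ?case by blast
  qed
  have "pinned_holder \<alpha> (2 * \<epsilon>) a p (\<lambda>x. h x - g x)"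
  proof (rule pinned_holderI)
    fix x y assume xy: "a \<le> x" "x < y" "y \<le> p"
    show "norm ((h x - g x) - (h y - g y)) \<le> 2 * \<epsilon> * (y - x) powr \<alpha> \<or>
      (norm (h x - g x) \<le> 2 * \<epsilon> * (y - x) powr \<alpha> \<and> norm (h y - g y) \<le> 2 * \<epsilon> * (y - x) powr \<alpha>)"
    proof (cases "y < p")
      case True
      then obtain n where "y < t n" using t_conv by blast
      then show ?thesis
        using pinned_holderD[of \<alpha> "2 * \<epsilon>" a "t n" "\<lambda>x. h x - g x" x y] pieces[of n] xy by auto
    next
      case False
      then obtain n where n: "x < t n" using t_conv xy by (metis order_less_le_trans)
      have "norm (h x - g x) \<le> 2 * \<epsilon> * (t n - x) powr \<alpha>"
        using pinned_holder_right_end[of \<alpha> "2 * \<epsilon>" a "t n" "\<lambda>x. h x - g x" x] pieces[of n] xy n by simp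
      also have "\<dots> \<le> 2 * \<epsilon> * (y - x) powr \<alpha>"
        using n t_p[of n] False xy assms(1,3) by (intro mult_left_mono powr_mono2) auto
      finally show ?thesis
        using False xy by (simp add: g_def)
    qed
  qed (use pieces[of 0] in \<open>auto simp: pinned_holder_def g_def\<close>)
  moreover have "\<exists>C. C-lipschitz_on {a..x} g" if x: "a \<le> x" "x < p" for x
  proof -
    obtain n where "x < t n" using t_conv x by blast
    then show ?thesis
      using pieces[of n] by (meson atLeastatMost_subset_iff less_imp_le lipschitz_on_subset order_refl)
  qed
  ultimately show ?thesis by blast
qed

lemma locally_lipschitz_approximation_right:
  fixes h :: "real \<Rightarrow> 'a::real_normed_vector"
  assumes "0 < \<alpha>" "\<alpha> < 1" "0 \<le> \<epsilon>" "p < b"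
    and loc: "\<And>x. x \<in> {p<..b} \<Longrightarrow> \<exists>\<delta>>0. holder_on \<alpha> \<epsilon> ({x - \<delta><..<x + \<delta>} \<inter> {p..b}) h"
  shows "\<exists>g. pinned_holder \<alpha> (2 * \<epsilon>) p b (\<lambda>x. h x - g x) \<and>
     (\<forall>x. p < x \<and> x \<le> b \<longrightarrow> (\<exists>C. C-lipschitz_on {x..b} g))"
proof -
  have "\<exists>g. pinned_holder \<alpha> (2 * \<epsilon>) (- b) (- p) (\<lambda>x. h (- x) - g x) \<and>
     (\<forall>x. - b \<le> x \<and> x < - p \<longrightarrow> (\<exists>C. C-lipschitz_on {- b..x} g))"
  proof (rule locally_lipschitz_approximation[OF assms(1-3)])
    fix x assume "x \<in> {- b..<- p}"
    then obtain \<delta> where "\<delta> > 0" "holder_on \<alpha> \<epsilon> ({- x - \<delta><..<- x + \<delta>} \<inter> {p..b}) h"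
      using loc[of "- x"] by auto
    moreover have "{x - \<delta><..<x + \<delta>} \<inter> {- b..- p} \<subseteq> uminus ` ({- x - \<delta><..<- x + \<delta>} \<inter> {p..b})"
    proof
      fix y assume "y \<in> {x - \<delta><..<x + \<delta>} \<inter> {- b..- p}"
      then show "y \<in> uminus ` ({- x - \<delta><..<- x + \<delta>} \<inter> {p..b})"
        by (intro image_eqI[of _ _ "- y"]) auto
    qed
    ultimately show "\<exists>\<delta>>0. holder_on \<alpha> \<epsilon> ({x - \<delta><..<x + \<delta>} \<inter> {- b..- p}) (\<lambda>x. h (- x))"
      using holder_on_reflect holder_on_subset by metis
  qed (use \<open>p < b\<close> in simp)
  then obtain g where g: "pinned_holder \<alpha> (2 * \<epsilon>) (- b) (- p) (\<lambda>x. h (- x) - g x)"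
    "\<And>x. - b \<le> x \<Longrightarrow> x < - p \<Longrightarrow> \<exists>C. C-lipschitz_on {- b..x} g"
    by blast
  have "\<exists>C. C-lipschitz_on {x..b} (\<lambda>x. g (- x))" if x: "p < x" "x \<le> b" for x
  proof -
    obtain C where C: "C-lipschitz_on {- b..- x} g"
      using g(2)[of "- x"] x by auto
    have "C-lipschitz_on {x..b} (\<lambda>x. g (- x))"
    proof (rule lipschitz_onI)
      fix y z assume "y \<in> {x..b}" "z \<in> {x..b}"
      then have "dist (g (- y)) (g (- z)) \<le> C * dist (- y) (- z)"
        by (intro lipschitz_onD[OF C]) auto
      then show "dist (g (- y)) (g (- z)) \<le> C * dist y z"
        by (simp add: dist_minus)
    qed (rule lipschitz_on_nonneg[OF C])
    then show ?thesis by blast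
  qed
  then show ?thesis
    using pinned_holder_reflect[OF g(1)] by (intro exI[of _ "\<lambda>x. g (- x)"]) auto
qed

section \<open>Finitely many exceptional points\<close>

definition lipschitz_near :: "(real \<Rightarrow> 'a::metric_space) \<Rightarrow> real set \<Rightarrow> real \<Rightarrow> bool" where
  "lipschitz_near g S x \<longleftrightarrow> (\<exists>\<delta>>0. \<exists>C. C-lipschitz_on ({x - \<delta><..<x + \<delta>} \<inter> S) g)"

lemma lipschitz_near_transform:
  assumes "lipschitz_near g S x" "0 < r"
    and "{x - r<..<x + r} \<inter> T \<subseteq> S"
    and "\<And>y. y \<in> {x - r<..<x + r} \<inter> T \<Longrightarrow> g' y = g y"
  shows "lipschitz_near g' T x"
proof -
  obtain \<delta> C where \<delta>: "\<delta> > 0" "C-lipschitz_on ({x - \<delta><..<x + \<delta>} \<inter> S) g"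
    using assms(1) by (auto simp: lipschitz_near_def)
  have "C-lipschitz_on ({x - min \<delta> r<..<x + min \<delta> r} \<inter> T) g"
    by (intro lipschitz_on_subset[OF \<delta>(2)]) (auto intro!: subsetD[OF assms(3)])
  then have "C-lipschitz_on ({x - min \<delta> r<..<x + min \<delta> r} \<inter> T) g'"
    by (rule lipschitz_on_transform) (auto intro!: assms(4))
  with \<delta>(1) \<open>0 < r\<close> show ?thesis
    unfolding lipschitz_near_def by (intro exI[of _ "min \<delta> r"]) auto
qed

text \<open>
  Each gluing step adds the gluing point to the exceptional set \<open>K\<close>. This is harmless, as only
  finitely many steps are made, and it removes any need to look at the gluing point: every
  other point has a neighbourhood inside one of the two pieces.
\<close>

lemma piecewise_locally_lipschitz_approximation:
  fixes h :: "real \<Rightarrow> 'a::real_normed_vector"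
  assumes "0 < \<alpha>" "\<alpha> < 1" "0 \<le> \<epsilon>" "a \<le> b" "finite F"
    and loc: "\<And>x. x \<in> {a..b} - F \<Longrightarrow> \<exists>\<delta>>0. holder_on \<alpha> \<epsilon> ({x - \<delta><..<x + \<delta>} \<inter> {a..b}) h"
  shows "\<exists>g K. pinned_holder \<alpha> (2 * \<epsilon>) a b (\<lambda>x. h x - g x) \<and> finite K \<and>
     (\<forall>x\<in>{a..b} - K. lipschitz_near g {a..b} x)"
proof -
  define P where "P u v \<longleftrightarrow> (\<exists>g K. pinned_holder \<alpha> (2 * \<epsilon>) u v (\<lambda>x. h x - g x) \<and> finite K \<and>
     (\<forall>x\<in>{u..v} - K. lipschitz_near g {u..v} x))" for u v
  have glue: "P u w" if uvw: "P u v" "P v w" "u \<le> v" "v \<le> w" for u v w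
  proof -
    obtain g K where g: "pinned_holder \<alpha> (2 * \<epsilon>) u v (\<lambda>x. h x - g x)" "finite K"
      "\<And>x. x \<in> {u..v} - K \<Longrightarrow> lipschitz_near g {u..v} x"
      using uvw(1) unfolding P_def by blast
    obtain g' K' where g': "pinned_holder \<alpha> (2 * \<epsilon>) v w (\<lambda>x. h x - g' x)" "finite K'"
      "\<And>x. x \<in> {v..w} - K' \<Longrightarrow> lipschitz_near g' {v..w} x"
      using uvw(2) unfolding P_def by blast
    have "lipschitz_near (\<lambda>x. if x \<le> v then g x else g' x) {u..w} x"
      if x: "x \<in> {u..w} - (K \<union> K' \<union> {v})" for x
    proof (cases "x < v")
      case True
      show ?thesis
        by (rule lipschitz_near_transform[OF g(3), of x "v - x"]) (use x True in auto)
    next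
      case False
      show ?thesis
        by (rule lipschitz_near_transform[OF g'(3), of x "x - v"]) (use x False in auto)
    qed
    moreover have "finite (K \<union> K' \<union> {v})" using g(2) g'(2) by simp
    moreover have "pinned_holder \<alpha> (2 * \<epsilon>) u w (\<lambda>x. h x - (if x \<le> v then g x else g' x))"
      using pinned_holder_glue_if[OF g(1) g'(1)] uvw assms(1,3) by simp
    ultimately show "P u w"
      unfolding P_def
      by (intro exI[of _ "\<lambda>x. if x \<le> v then g x else g' x"] exI[of _ "K \<union> K' \<union> {v}"]) simp
  qed
  have P_refl: "P u u" for u
    unfolding P_def using \<open>0 < \<alpha>\<close>
    by (intro exI[of _ h] exI[of _ "{u}"]) (auto intro: pinned_holder_refl)
  have loc': "\<exists>\<delta>>0. holder_on \<alpha> \<epsilon> ({x - \<delta><..<x + \<delta>} \<inter> {u..v}) h"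
    if xuv: "x \<in> {a..b} - F" "a \<le> u" "v \<le> b" for x u v
  proof -
    obtain \<delta> where "\<delta> > 0" "holder_on \<alpha> \<epsilon> ({x - \<delta><..<x + \<delta>} \<inter> {a..b}) h"
      using loc[OF xuv(1)] by blast
    moreover have "{u..v} \<subseteq> {a..b}" using xuv by auto
    ultimately show ?thesis by (meson holder_on_subset inf_mono order_refl)
  qed
  have left: "P u p" if u: "a \<le> u" "u < p" "p \<le> b" "{u..<p} \<inter> F = {}" for u p
  proof -
    have "\<exists>g. pinned_holder \<alpha> (2 * \<epsilon>) u p (\<lambda>x. h x - g x) \<and>
     (\<forall>x. u \<le> x \<and> x < p \<longrightarrow> (\<exists>C. C-lipschitz_on {u..x} g))"
      by (rule locally_lipschitz_approximation[OF assms(1-3) u(2)], rule loc') (use u in auto)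
    then obtain g where g: "pinned_holder \<alpha> (2 * \<epsilon>) u p (\<lambda>x. h x - g x)"
      "\<And>x. u \<le> x \<Longrightarrow> x < p \<Longrightarrow> \<exists>C. C-lipschitz_on {u..x} g"
      by blast
    have "lipschitz_near g {u..p} x" if x: "x \<in> {u..p} - {p}" for x
    proof -
      obtain C where "C-lipschitz_on {u..(x + p) / 2} g"
        using g(2)[of "(x + p) / 2"] x by auto
      then have "C-lipschitz_on ({x - (p - x) / 2<..<x + (p - x) / 2} \<inter> {u..p}) g"
        by (rule lipschitz_on_subset) (auto simp: field_simps)
      then show ?thesis
        unfolding lipschitz_near_def using x by (intro exI[of _ "(p - x) / 2"]) auto
    qed
    with g(1) show ?thesis unfolding P_def by blast
  qed
  have right: "P p v" if v: "a \<le> p" "p < v" "v \<le> b" "{p<..v} \<inter> F = {}" for p v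
  proof -
    have "\<exists>g. pinned_holder \<alpha> (2 * \<epsilon>) p v (\<lambda>x. h x - g x) \<and>
     (\<forall>x. p < x \<and> x \<le> v \<longrightarrow> (\<exists>C. C-lipschitz_on {x..v} g))"
      by (rule locally_lipschitz_approximation_right[OF assms(1-3) v(2)], rule loc') (use v in auto)
    then obtain g where g: "pinned_holder \<alpha> (2 * \<epsilon>) p v (\<lambda>x. h x - g x)"
      "\<And>x. p < x \<Longrightarrow> x \<le> v \<Longrightarrow> \<exists>C. C-lipschitz_on {x..v} g"
      by blast
    have "lipschitz_near g {p..v} x" if x: "x \<in> {p..v} - {p}" for x
    proof -
      obtain C where "C-lipschitz_on {(x + p) / 2..v} g"
        using g(2)[of "(x + p) / 2"] x by auto
      then have "C-lipschitz_on ({x - (x - p) / 2<..<x + (x - p) / 2} \<inter> {p..v}) g"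
        by (rule lipschitz_on_subset) (auto simp: field_simps)
      then show ?thesis
        unfolding lipschitz_near_def using x by (intro exI[of _ "(x - p) / 2"]) auto
    qed
    with g(1) show ?thesis unfolding P_def by blast
  qed
  have "a \<le> a \<and> b \<le> b \<longrightarrow> P a b"
    using \<open>a \<le> b\<close>
  proof (induction rule: Bolzano[where P = "\<lambda>u v. a \<le> u \<and> v \<le> b \<longrightarrow> P u v"])
    case (trans u v w)
    then show ?case using glue[of u v w] by auto
  next
    case (local x)
    \<comment> \<open>The one-sided approximations assume nothing at the end point that they share, so points
      inside and outside \<open>F\<close> need not be distinguished.\<close>
    obtain \<delta> where \<delta>: "\<delta> > 0" "\<And>y. y \<in> F \<Longrightarrow> y \<noteq> x \<Longrightarrow> \<delta> \<le> dist x y"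
      using finite_set_avoid[OF \<open>finite F\<close>, of x] by blast
    have "P u v" if uv: "u \<le> x" "x \<le> v" "v - u < \<delta>" "a \<le> u" "v \<le> b" for u v
    proof -
      have avoid: "y = x" if "y \<in> {u..v}" "y \<in> F" for y
      proof (rule ccontr)
        assume "y \<noteq> x"
        then have "\<delta> \<le> \<bar>x - y\<bar>"
          using \<delta>(2)[of y] that by (simp add: dist_real_def)
        moreover have "\<bar>x - y\<bar> \<le> v - u" using that(1) uv by auto
        ultimately show False using uv by simp
      qed
      have "{u..<x} \<inter> F = {}" "{x<..v} \<inter> F = {}"
      proof -
        have "F \<inter> {u..v} \<subseteq> {x}" using avoid by auto
        moreover have "{u..<x} \<subseteq> {u..v} - {x}" "{x<..v} \<subseteq> {u..v} - {x}" using uv by auto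
        ultimately show "{u..<x} \<inter> F = {}" "{x<..v} \<inter> F = {}" by blast+
      qed
      then have "P u x" "P x v"
        using left[of u x] right[of x v] P_refl[of x] uv
        by (cases "u = x"; cases "v = x"; simp)+
      then show ?thesis using glue uv by blast
    qed
    with \<delta>(1) show ?case by blast
  qed
  then show ?thesis unfolding P_def by simp
qed

section \<open>Neighbourhoods in the unit interval\<close>

lemma nhd_unit_interval:
  assumes "x \<in> {0..1}" "0 < \<delta>"
  shows "nhd_unit x ({x - \<delta><..<x + \<delta>} \<inter> {0..1})"
  unfolding nhd_unit_def
proof (intro conjI exI)
  show "openin (top_of_set {0..1}) ({x - \<delta><..<x + \<delta>} \<inter> {0..1})"
    by (metis inf_commute open_greaterThanLessThan openin_open_Int)
qed (use assms in auto)

lemma nhd_unitE: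
  assumes "nhd_unit x U"
  obtains \<delta> where "\<delta> > 0" "{x - \<delta><..<x + \<delta>} \<inter> {0..1} \<subseteq> U"
proof -
  obtain T where "open T" "x \<in> T" "T \<inter> {0..1} \<subseteq> U"
    using assms unfolding nhd_unit_def openin_open by (metis Int_commute Int_iff)
  then obtain \<delta> where "\<delta> > 0" "ball x \<delta> \<subseteq> T"
    using open_contains_ball by blast
  then show thesis
    using \<open>T \<inter> {0..1} \<subseteq> U\<close> that[of \<delta>] by (auto simp: ball_eq_greaterThanLessThan)
qed

text \<open>The Hoelder quotient of a Lipschitz function is at most \<open>C * \<bar>u - v\<bar> powr (1 - \<alpha>)\<close>.\<close>

lemma lipschitz_on_imp_uniform_lip:
  assumes "\<alpha> < 1" and C: "C-lipschitz_on U g"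
  shows "uniform_lip \<alpha> g U"
  unfolding uniform_lip_iff
proof (intro allI impI)
  fix \<epsilon> :: real assume "\<epsilon> > 0"
  have "C \<ge> 0" using C by (rule lipschitz_on_nonneg)
  \<comment> \<open>The solution of \<open>(C + 1) * \<delta> powr (1 - \<alpha>) = \<epsilon>\<close>; the summand \<open>1\<close> covers \<open>C = 0\<close>.\<close>
  define \<delta> where "\<delta> = (\<epsilon> / (C + 1)) powr (1 / (1 - \<alpha>))"
  have pos: "\<epsilon> / (C + 1) > 0" using \<open>\<epsilon> > 0\<close> \<open>C \<ge> 0\<close> by simp
  have "\<delta> > 0" using pos \<open>C \<ge> 0\<close> \<open>\<epsilon> > 0\<close> by (simp add: \<delta>_def)
  moreover have "norm (g u - g v) / \<bar>u - v\<bar> powr \<alpha> < \<epsilon>"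
    if uv: "u \<in> U" "v \<in> U" "u \<noteq> v" "\<bar>u - v\<bar> < \<delta>" for u v
  proof -
    have "\<bar>u - v\<bar> powr (1 - \<alpha>) < \<delta> powr (1 - \<alpha>)"
      using uv \<open>\<alpha> < 1\<close> by (intro powr_less_mono2) auto
    also have "\<delta> powr (1 - \<alpha>) = \<epsilon> / (C + 1)"
      using pos \<open>\<alpha> < 1\<close> \<open>\<epsilon> > 0\<close> \<open>C \<ge> 0\<close> by (simp add: \<delta>_def powr_powr)
    finally have less: "\<bar>u - v\<bar> powr (1 - \<alpha>) < \<epsilon> / (C + 1)" .
    have "norm (g u - g v) \<le> C * \<bar>u - v\<bar>"
      using lipschitz_onD[OF C uv(1,2)] by (simp add: dist_norm)
    then have "norm (g u - g v) / \<bar>u - v\<bar> powr \<alpha> \<le> C * \<bar>u - v\<bar> / \<bar>u - v\<bar> powr \<alpha>"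
      by (rule divide_right_mono) simp
    also have "\<dots> = C * \<bar>u - v\<bar> powr (1 - \<alpha>)"
      using uv by (simp add: powr_diff)
    also have "\<dots> \<le> (C + 1) * \<bar>u - v\<bar> powr (1 - \<alpha>)"
      by (simp add: mult_right_mono)
    also have "\<dots> < (C + 1) * (\<epsilon> / (C + 1))"
      using less \<open>C \<ge> 0\<close> by (intro mult_strict_left_mono) auto
    also have "\<dots> = \<epsilon>" using \<open>C \<ge> 0\<close> by simp
    finally show ?thesis .
  qed
  ultimately show "\<exists>\<delta>>0. \<forall>u\<in>U. \<forall>v\<in>U. u \<noteq> v \<and> \<bar>u - v\<bar> < \<delta> \<longrightarrow>
        norm (g u - g v) / \<bar>u - v\<bar> powr \<alpha> < \<epsilon>"
    by blast
qed

lemma lipschitz_near_imp_noncritical_point: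
  assumes "\<alpha> < 1" "x \<in> {0..1}" "lipschitz_near g {0..1} x"
  shows "noncritical_point \<alpha> g x"
  using assms nhd_unit_interval lipschitz_on_imp_uniform_lip
  unfolding lipschitz_near_def noncritical_point_def by metis

lemma noncritical_point_imp_holder_on:
  assumes "noncritical_point \<alpha> g x" "\<epsilon> > 0"
  obtains \<delta> where "\<delta> > 0" "holder_on \<alpha> \<epsilon> ({x - \<delta><..<x + \<delta>} \<inter> {0..1}) g"
proof -
  obtain U where U: "nhd_unit x U" "uniform_lip \<alpha> g U"
    using assms(1) by (auto simp: noncritical_point_def)
  obtain r where r: "r > 0" "{x - r<..<x + r} \<inter> {0..1} \<subseteq> U"
    using nhd_unitE[OF U(1)] .
  obtain s where s: "s > 0" "\<And>u v. u \<in> U \<Longrightarrow> v \<in> U \<Longrightarrow> u \<noteq> v \<Longrightarrow> \<bar>u - v\<bar> < s \<Longrightarrow>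
      norm (g u - g v) / \<bar>u - v\<bar> powr \<alpha> < \<epsilon>"
    using U(2)[unfolded uniform_lip_iff, THEN spec, THEN mp, OF assms(2)] by auto
  have "norm (g u - g v) \<le> \<epsilon> * \<bar>u - v\<bar> powr \<alpha>"
    if "u \<in> {x - min r (s / 2)<..<x + min r (s / 2)} \<inter> {0..1}"
       "v \<in> {x - min r (s / 2)<..<x + min r (s / 2)} \<inter> {0..1}" for u v
  proof (cases "u = v")
    case False
    have "u \<in> U" "v \<in> U" using that by (auto intro!: subsetD[OF r(2)])
    moreover have "\<bar>u - v\<bar> < s" using that by auto
    ultimately have "norm (g u - g v) / \<bar>u - v\<bar> powr \<alpha> < \<epsilon>"
      using False s(2) by blast
    then show ?thesis using False by (simp add: pos_divide_less_eq)
  qed simp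
  then show thesis
    using r(1) s(1) by (intro that[of "min r (s / 2)"]) (auto simp: holder_on_def)
qed

section \<open>The closure\<close>

lemma holder_dist_le_iff:
  assumes "f \<in> holder_space \<alpha>" "g \<in> holder_space \<alpha>" "0 \<le> c"
  shows "holder_dist \<alpha> f g \<le> c \<longleftrightarrow> holder_on \<alpha> c {0..1} (\<lambda>x. f x - g x)"
proof -
  have "holder_sup \<alpha> {0..1} (\<lambda>x. f x - g x) < \<infinity>"
    using holder_space_diff[OF assms(1,2)] by (simp add: holder_space_def)
  then obtain B where "B \<ge> 0" "holder_sup \<alpha> {0..1} (\<lambda>x. f x - g x) = ennreal B"
    by (cases "holder_sup \<alpha> {0..1} (\<lambda>x. f x - g x)") auto
  then have "holder_dist \<alpha> f g \<le> c \<longleftrightarrow> holder_sup \<alpha> {0..1} (\<lambda>x. f x - g x) \<le> ennreal c"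
    using assms(3) by (simp add: holder_dist_def holder_norm_def)
  then show ?thesis by (simp add: holder_sup_le_iff assms(3))
qed

lemma holder_omega_if_approximable:
  assumes h: "h \<in> holder_space \<alpha>"
    and approx: "\<And>\<epsilon>. \<epsilon> > 0 \<Longrightarrow> \<exists>g\<in>holder_p \<alpha>. holder_dist \<alpha> h g \<le> \<epsilon>"
  shows "h \<in> holder_omega \<alpha>"
proof -
  have "\<exists>F. finite F \<and> F \<subseteq> {0..1} \<and>
      (\<forall>x\<in>{0..1} - F. \<exists>U. nhd_unit x U \<and> holder_sup \<alpha> U h \<le> ennreal \<epsilon>)"
    if "\<epsilon> > 0" for \<epsilon> :: real
  proof -
    obtain g where g: "g \<in> holder_space \<alpha>" "finite (critical_points \<alpha> g)" "holder_dist \<alpha> h g \<le> \<epsilon> / 2"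
      using approx[of "\<epsilon> / 2"] \<open>\<epsilon> > 0\<close> by (auto simp: holder_p_def)
    have close: "holder_on \<alpha> (\<epsilon> / 2) {0..1} (\<lambda>x. g x - h x)"
      using g holder_dist_le_iff[OF h g(1), of "\<epsilon> / 2"] that
      by (auto simp: holder_on_def norm_minus_commute algebra_simps)
    have "\<exists>U. nhd_unit x U \<and> holder_sup \<alpha> U h \<le> ennreal \<epsilon>"
      if x: "x \<in> {0..1} - critical_points \<alpha> g" for x
    proof -
      have "noncritical_point \<alpha> g x" "\<epsilon> / 2 > 0"
        using x \<open>\<epsilon> > 0\<close> by (auto simp: critical_points_def)
      then obtain \<delta> where \<delta>: "\<delta> > 0" "holder_on \<alpha> (\<epsilon> / 2) ({x - \<delta><..<x + \<delta>} \<inter> {0..1}) g"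
        by (rule noncritical_point_imp_holder_on)
      have "holder_on \<alpha> (\<epsilon> / 2) ({x - \<delta><..<x + \<delta>} \<inter> {0..1}) (\<lambda>x. g x - h x)"
        by (rule holder_on_subset[OF close]) auto
      from holder_on_diff[OF \<delta>(2) this]
      have "holder_on \<alpha> \<epsilon> ({x - \<delta><..<x + \<delta>} \<inter> {0..1}) h" by simp
      then have "holder_sup \<alpha> ({x - \<delta><..<x + \<delta>} \<inter> {0..1}) h \<le> ennreal \<epsilon>"
        using \<open>\<epsilon> > 0\<close> by (simp add: holder_sup_le_iff)
      moreover have "nhd_unit x ({x - \<delta><..<x + \<delta>} \<inter> {0..1})"
        using x \<delta>(1) by (intro nhd_unit_interval) auto
      ultimately show ?thesis by blast
    qed
    with g(2) show ?thesis
      by (intro exI[of _ "critical_points \<alpha> g"]) (auto simp: critical_points_def)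
  qed
  with h show ?thesis by (simp add: holder_omega_def)
qed

lemma approximable_if_holder_omega:
  assumes "0 < \<alpha>" "\<alpha> < 1" "h \<in> holder_omega \<alpha>" "\<epsilon> > 0"
  shows "\<exists>g\<in>holder_p \<alpha>. holder_dist \<alpha> h g \<le> \<epsilon>"
proof -
  have h: "h \<in> holder_space \<alpha>"
    using assms(3) by (simp add: holder_omega_def)
  \<comment> \<open>Interpolation and the step from pinned to genuine Hoelder bounds lose a factor \<open>2\<close> each.\<close>
  have "\<epsilon> / 4 > 0" using \<open>\<epsilon> > 0\<close> by simp
  then have "\<exists>F. finite F \<and> F \<subseteq> {0..1} \<and>
      (\<forall>x\<in>{0..1} - F. \<exists>U. nhd_unit x U \<and> holder_sup \<alpha> U h \<le> ennreal (\<epsilon> / 4))"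
    using assms(3) by (simp add: holder_omega_def)
  then obtain F where F: "finite F"
      "\<And>x. x \<in> {0..1} - F \<Longrightarrow> \<exists>U. nhd_unit x U \<and> holder_sup \<alpha> U h \<le> ennreal (\<epsilon> / 4)"
    by metis
  have "\<exists>\<delta>>0. holder_on \<alpha> (\<epsilon> / 4) ({x - \<delta><..<x + \<delta>} \<inter> {0..1}) h" if x: "x \<in> {0..1} - F" for x
  proof -
    obtain U where U: "nhd_unit x U" "holder_on \<alpha> (\<epsilon> / 4) U h"
      using F(2)[OF x] \<open>\<epsilon> / 4 > 0\<close> holder_sup_le_iff[of "\<epsilon> / 4" \<alpha>] by auto
    obtain \<delta> where "\<delta> > 0" "{x - \<delta><..<x + \<delta>} \<inter> {0..1} \<subseteq> U"
      using nhd_unitE[OF U(1)] .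
    then show ?thesis using holder_on_subset[OF U(2)] by blast
  qed
  with assms(1,2) F(1) \<open>\<epsilon> / 4 > 0\<close>
  have "\<exists>g K. pinned_holder \<alpha> (2 * (\<epsilon> / 4)) 0 1 (\<lambda>x. h x - g x) \<and> finite K \<and>
     (\<forall>x\<in>{0..1} - K. lipschitz_near g {0..1} x)"
    by (intro piecewise_locally_lipschitz_approximation[of \<alpha> "\<epsilon> / 4" 0 1 F]) auto
  then obtain g K where g: "pinned_holder \<alpha> (2 * (\<epsilon> / 4)) 0 1 (\<lambda>x. h x - g x)" "finite K"
     "\<And>x. x \<in> {0..1} - K \<Longrightarrow> lipschitz_near g {0..1} x"
    by blast
  define g0 where "g0 x = (if x \<in> {0..1} then g x else 0)" for x
  have "holder_on \<alpha> (2 * (2 * (\<epsilon> / 4))) {0..1} (\<lambda>x. h x - g x)"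
    using \<open>\<epsilon> > 0\<close> by (intro pinned_holder_imp_holder_on[OF g(1)]) simp
  then have close: "holder_on \<alpha> \<epsilon> {0..1} (\<lambda>x. h x - g0 x)"
    by (auto simp: holder_on_def g0_def)
  have "holder_sup \<alpha> {0..1} h < \<infinity>"
    using h by (simp add: holder_space_def)
  then obtain B where B: "B \<ge> 0" "holder_sup \<alpha> {0..1} h = ennreal B"
    by (cases "holder_sup \<alpha> {0..1} h") auto
  then have "holder_on \<alpha> B {0..1} h"
    using holder_sup_le_iff[of B \<alpha> "{0..1}" h] by simp
  from holder_on_diff[OF this close]
  have "holder_sup \<alpha> {0..1} g0 \<le> ennreal (B + \<epsilon>)"
    using B(1) \<open>\<epsilon> > 0\<close> by (simp add: holder_sup_le_iff del: ennreal_plus)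
  then have "holder_sup \<alpha> {0..1} g0 < \<infinity>"
    using ennreal_less_top le_less_trans by (metis infinity_ennreal_def)
  moreover have "g0 0 = 0"
    using g(1) h by (simp add: pinned_holder_def g0_def holder_space_def)
  ultimately have g0: "g0 \<in> holder_space \<alpha>"
    by (auto simp: holder_space_def g0_def)
  have "noncritical_point \<alpha> g0 x" if x: "x \<in> {0..1} - K" for x
  proof (rule lipschitz_near_imp_noncritical_point[OF \<open>\<alpha> < 1\<close>])
    show "lipschitz_near g0 {0..1} x"
      by (rule lipschitz_near_transform[OF g(3)[OF x], of 1]) (auto simp: g0_def)
  qed (use x in auto)
  then have "critical_points \<alpha> g0 \<subseteq> K"
    by (auto simp: critical_points_def)
  then have "g0 \<in> holder_p \<alpha>"
    using g0 g(2) finite_subset by (auto simp: holder_p_def)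
  moreover have "holder_dist \<alpha> h g0 \<le> \<epsilon>"
    using holder_dist_le_iff[OF h g0] close \<open>\<epsilon> > 0\<close> by simp
  ultimately show ?thesis by blast
qed

theorem proposition2p12:
  fixes \<alpha> :: real
  assumes "0 < \<alpha>" and "\<alpha> < 1"
  shows "Metric_space.mtopology (holder_space \<alpha> :: (real \<Rightarrow> 'a::real_normed_field) set) (holder_dist \<alpha>)
           closure_of (holder_p \<alpha>) = holder_omega \<alpha>"
proof -
  interpret Metric_space "holder_space \<alpha> :: (real \<Rightarrow> 'a) set" "holder_dist \<alpha>"
    by (rule Metric_space_holder)
  have "mtopology closure_of holder_p \<alpha> =
      {h \<in> holder_space \<alpha>. \<forall>\<epsilon>>0. \<exists>g\<in>holder_p \<alpha>. holder_dist \<alpha> h g \<le> \<epsilon>}"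
    unfolding metric_closure_of_alt by (auto simp: holder_p_def)
  also have "\<dots> = holder_omega \<alpha>"
  proof (intro subset_antisym subsetI)
    fix h :: "real \<Rightarrow> 'a" assume "h \<in> holder_omega \<alpha>"
    then show "h \<in> {h \<in> holder_space \<alpha>. \<forall>\<epsilon>>0. \<exists>g\<in>holder_p \<alpha>. holder_dist \<alpha> h g \<le> \<epsilon>}"
      using approximable_if_holder_omega[OF assms, of h] by (auto simp: holder_omega_def)
  qed (auto intro: holder_omega_if_approximable)
  finally show ?thesis .
qed

end
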